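(* Let $p$ and $q$ be probability density functions in $\mathcal{G}$ with respective supports $S_q\subseteq S_p$ and such that $\mathcal{F}(p)\cap\mathcal{F}(q)\neq\emptyset$. Let $$d_{\mathcal{H}}(p,q)=\sup_{l\in\mathcal{H}}\left|\mathrm{E}_q[l(X)]-\mathrm{E}_p[l(X)]\right|$$ for some class of functions $\mathcal{H}$. Suppose that for all $l\in\mathcal{H}$ the function $f_l^p$, solution of the Stein equation $\mathcal{T}_pf(x)=(l(x)-\mathrm{E}_p[l(X)])\mathbb{I}_{S_p}(x)$, exists and satisfies $f_l^p\in\mathcal{F}(p)\cap\mathcal{F}(q)$. Then $$d_{\mathcal{H}}(p,q)\le\kappa_{\mathcal{H}}^p\sqrt{\mathcal{J}(p,q)},$$ where $$\kappa_{\mathcal{H}}^p=\sup_{l\in\mathcal{H}}\sqrt{\mathrm{E}_q\left[(f_l^p(X))^2\right]}\quad\text{and}\quad\mathcal{J}(p,q)=\mathrm{E}_q\left[(r(p,q)(X))^2\right],$$ the latter being the generalized Fisher information distance between the densities $p$ and $q$ (possibly infinite).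
   Context: $\mathcal{G}$ is the collection of positive real functions $x\mapsto p(x)$ such that (i) the support $S_p := \{x \in \mathbb{R} : p(x) \text{ (exists and) is positive}\}$ is an interval with closure $\bar S_p=[a,b]$ for some $-\infty\le a<b\le\infty$; (ii) $p$ is differentiable (in the usual sense) at every point of $(a,b)$, with derivative $p'$; (iii) $\int_{S_p}p(y)\,dy=1$. Conventions: $\frac{1}{p(x)}$ is understood to be $0$ when $x\notin S_p$; $\mathbb{I}_A$ is the indicator function of $A$; for $p\in\mathcal{G}$, $\mathrm{E}_p[l(X)]:=\int_{S_p}l(x)p(x)\,dx$. The same notation applies with $q$ in place of $p$. For $p\in\mathcal{G}$ with $\bar S_p=[a,b]$, the class of test functions $\mathcal{F}(p)$ is the collection of functions $f:\mathbb{R}\to\mathbb{R}$ such that $x\mapsto f(x)p(x)$ is differentiable on the interior of $S_p$ and $f(a^+)p(a^+)=f(b^-)p(b^-)=0$ (that is, $f(x)p(x)\to 0$ as $x\to a^+$ and as $x\to b^-$). The Stein operator $\mathcal{T}_p$ maps $f\in\mathcal{F}(p)$ to the function $\mathcal{T}_pf:\mathbb{R}\to\mathbb{R}$, $\mathcal{T}_pf(x):=\frac{1}{p(x)}\left.\frac{d}{dy}(f(y)p(y))\right|_{y=x}$ (hence $\mathcal{T}_pf(x)=0$ for $x\notin S_p$). For $S_q\subseteq S_p$, $r(p,q)(x):=\left(\frac{p'(x)}{p(x)}-\frac{q'(x)}{q(x)}\right)\mathbb{I}_{S_p}(x)$. The class $\mathcal{H}$ consists of real-valued functions $l$ for which $\mathrm{E}_p[l(X)]$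 and $\mathrm{E}_q[l(X)]$ exist (as required for the definition of $d_{\mathcal{H}}$ and $f_l^p$). *)

theory Defs
  imports "HOL-Analysis.Analysis"
begin

text \<open>
  Densities are total functions on the reals that take the value 0 wherever the density is not
  positive or not defined. With division by zero equal to zero, the convention that
  \<open>1 / p x\<close> is 0 off the support is then automatic for members of the class below.
\<close>

definition supp :: "(real \<Rightarrow> real) \<Rightarrow> real set" where
  "supp p = {x. 0 < p x}"

text \<open>
  The support is an interval whose closure is the set of reals in \<open>[a, b]\<close>, with possibly infinite
  endpoints; \<open>a\<close> and \<open>b\<close> are uniquely determined by \<open>p\<close>.
\<close>

definition support_ends :: "(real \<Rightarrow> real) \<Rightarrow> ereal \<Rightarrow> ereal \<Rightarrow> bool" where
  "support_ends p a b \<longleftrightarrow>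
     a < b \<and> is_interval (supp p) \<and> closure (supp p) = {x. a \<le> ereal x \<and> ereal x \<le> b}"

definition density_class :: "(real \<Rightarrow> real) set" where
  "density_class =
     {p. (\<forall>x. 0 \<le> p x)
       \<and> (\<exists>a b. support_ends p a b \<and> (\<forall>x\<in>einterval a b. p differentiable at x))
       \<and> (LBINT x:supp p. p x) = 1}"

definition expect_exists :: "(real \<Rightarrow> real) \<Rightarrow> (real \<Rightarrow> real) \<Rightarrow> bool" where
  "expect_exists p l \<longleftrightarrow> set_integrable lborel (supp p) (\<lambda>x. l x * p x)"

definition expect :: "(real \<Rightarrow> real) \<Rightarrow> (real \<Rightarrow> real) \<Rightarrow> real" where
  "expect p l = (LBINT x:supp p. l x * p x)"

text \<open>Expectation of a nonnegative function, possibly infinite.\<close>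

definition nn_expect :: "(real \<Rightarrow> real) \<Rightarrow> (real \<Rightarrow> real) \<Rightarrow> ennreal" where
  "nn_expect p l = (\<integral>\<^sup>+ x\<in>supp p. ennreal (l x * p x) \<partial>lborel)"

definition ennreal_sqrt :: "ennreal \<Rightarrow> ennreal" where
  "ennreal_sqrt x = (if x = top then top else ennreal (sqrt (enn2real x)))"

text \<open>
  The one-sided limits of \<open>f p\<close> are taken in the extended reals, so that they are limits at
  minus or plus infinity when the corresponding endpoint is infinite.
\<close>

definition test_functions :: "(real \<Rightarrow> real) \<Rightarrow> (real \<Rightarrow> real) set" where
  "test_functions p =
     {f. (\<forall>x\<in>interior (supp p). (\<lambda>y. f y * p y) differentiable at x)
       \<and> (\<exists>a b. support_ends p a b
            \<and> (((\<lambda>y. f y * p y) \<circ> real_of_ereal) \<longlongrightarrow> 0) (at_right a)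
            \<and> (((\<lambda>y. f y * p y) \<circ> real_of_ereal) \<longlongrightarrow> 0) (at_left b))}"

definition stein_op :: "(real \<Rightarrow> real) \<Rightarrow> (real \<Rightarrow> real) \<Rightarrow> real \<Rightarrow> real" where
  "stein_op p f x = 1 / p x * deriv (\<lambda>y. f y * p y) x"

text \<open>
  Test functions need not make \<open>f p\<close> differentiable at an endpoint of the support that belongs
  to the support, so the Stein equation is not imposed at such (at most two) points, where
  \<open>deriv\<close> would be an arbitrary value.
\<close>

definition stein_equation :: "(real \<Rightarrow> real) \<Rightarrow> (real \<Rightarrow> real) \<Rightarrow> (real \<Rightarrow> real) \<Rightarrow> bool" where
  "stein_equation p l f \<longleftrightarrow>
     (\<forall>x. x \<notin> supp p - interior (supp p) \<longrightarrow>
        stein_op p f x = (l x - expect p l) * indicator (supp p) x)"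

definition score_diff :: "(real \<Rightarrow> real) \<Rightarrow> (real \<Rightarrow> real) \<Rightarrow> real \<Rightarrow> real" where
  "score_diff p q x = (deriv p x / p x - deriv q x / q x) * indicator (supp p) x"

definition fisher_dist :: "(real \<Rightarrow> real) \<Rightarrow> (real \<Rightarrow> real) \<Rightarrow> ennreal" where
  "fisher_dist p q = nn_expect q (\<lambda>x. (score_diff p q x)\<^sup>2)"

definition sup_dist ::
  "(real \<Rightarrow> real) set \<Rightarrow> (real \<Rightarrow> real) \<Rightarrow> (real \<Rightarrow> real) \<Rightarrow> ennreal" where
  "sup_dist H p q = (SUP l\<in>H. ennreal \<bar>expect q l - expect p l\<bar>)"

text \<open>Here \<open>F l\<close> is the solution of the Stein equation for \<open>p\<close> and \<open>l\<close>.\<close>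

definition kappa ::
  "(real \<Rightarrow> real) set \<Rightarrow> ((real \<Rightarrow> real) \<Rightarrow> real \<Rightarrow> real) \<Rightarrow> (real \<Rightarrow> real) \<Rightarrow> ennreal" where
  "kappa H F q = (SUP l\<in>H. ennreal_sqrt (nn_expect q (\<lambda>x. (F l x)\<^sup>2)))"

end

theory Submission
  imports Defs
begin

text \<open>
  On the interior \<open>U\<close> of the support of \<open>q\<close> the functions \<open>p\<close>, \<open>q\<close>, \<open>f p\<close>, \<open>f q\<close> are all differentiable.
  Differentiating the identity \<open>(f p) q = (f q) p\<close> gives \<open>(T_p f) q = (f q)' + f r q\<close> with
  \<open>r = r(p, q)\<close>: the two Stein operators differ by multiplication with the score difference
  (\<open>stein_op_eq_deriv_plus_score_diff\<close>). If \<open>f\<close> solves the Stein equation of \<open>p\<close> for \<open>l\<close>, the left-hand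
  side is \<open>(l - E_p l) q\<close>, whose integral is \<open>E_q l - E_p l\<close>. The total derivative \<open>(f q)'\<close> contributes
  nothing, because \<open>f q\<close> vanishes at both ends of the support. What is left is the integral of
  \<open>f r q\<close>, and the Cauchy--Schwarz inequality with weight \<open>q\<close> bounds it by
  \<open>sqrt (E_q f\<^sup>2) * sqrt (J(p, q))\<close>.

  Neither \<open>(f q)'\<close> nor \<open>f r q\<close> is known to be Lebesgue integrable. In
  \<open>abs_integral_le_nn_integral_diff_deriv\<close> the derivative is therefore integrated over compact
  subintervals of \<open>U\<close> only: there the fundamental theorem for the gauge integral applies to any
  everywhere differentiable function, and the boundary terms are sent to zero by exhausting \<open>U\<close>. The bound is
  formulated with a nonnegative, possibly infinite, integral of \<open>\<bar>f r q\<bar>\<close>, and Cauchy--Schwarz is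
  used for such integrals too. This also settles the products of zero and infinity, which count
  as zero: when one of \<open>E_q f\<^sup>2\<close> and \<open>J(p, q)\<close> vanishes, \<open>f r q = 0\<close> almost everywhere, no matter
  how large the other one is.
\<close>

section \<open>Interior and boundary of the support\<close>

lemma interior_ereal_interval:
  fixes a b :: ereal
  shows "interior {x. a \<le> ereal x \<and> ereal x \<le> b} = einterval a b"
proof -
  have "{x. a \<le> ereal x \<and> ereal x \<le> b} = {x. a \<le> ereal x} \<inter> {x. ereal x \<le> b}"
    by auto
  moreover have "interior {x. a \<le> ereal x} = {x. a < ereal x}"
  proof (cases a)
    case (real r)
    then show ?thesis using interior_real_atLeast[of r] by (simp add: atLeast_def greaterThan_def)
  qed auto
  moreover have "interior {x. ereal x \<le> b} = {x. ereal x < b}"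
  proof (cases b)
    case (real r)
    then show ?thesis using interior_real_atMost[of r] by (simp add: atMost_def lessThan_def)
  qed auto
  ultimately show ?thesis
    by (auto simp: einterval_def)
qed

text \<open>
  Passing to the closure does not change the interior of a convex set. In particular the
  endpoints provided by the density class and those provided by the class of test functions
  bound the same open interval, the interior of the support.
\<close>
lemma interior_supp:
  assumes "support_ends p a b"
  shows "interior (supp p) = einterval a b"
proof -
  have "interior (supp p) = interior (closure (supp p))"
    using assms convex_interior_closure is_interval_convex
    unfolding support_ends_def by metis
  then show ?thesis
    using assms by (simp add: support_ends_def interior_ereal_interval)
qed

text \<open>
  The Stein equation and the differentiability of \<open>f p\<close> are only available on the interior of the
  support; expectations do not see the difference.
\<close>
lemma null_supp_boundary:
  assumes "support_ends p a b"
  shows "supp p - interior (supp p) \<in> null_sets lborel"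
proof (rule finite_imp_null_set_lborel, rule finite_subset)
  have "supp p \<subseteq> {x. a \<le> ereal x \<and> ereal x \<le> b}"
    using assms closure_subset unfolding support_ends_def by blast
  then show "supp p - interior (supp p) \<subseteq> {real_of_ereal a, real_of_ereal b}"
    by (force simp: interior_supp[OF assms] einterval_def not_less dest: antisym)
qed simp

section \<open>Measurability of derivatives\<close>

lemma borel_measurable_differentiable_on_open:
  fixes G :: "real \<Rightarrow> real"
  assumes "open U" "\<And>x. x \<in> U \<Longrightarrow> G differentiable at x"
  shows "(\<lambda>x. indicator U x * G x) \<in> borel_measurable borel"
  using borel_measurable_continuous_on_indicator[of U G] assms
  by (simp add: continuous_on_eq_continuous_at differentiable_imp_continuous_within)

text \<open>
  The derivative is the pointwise limit of the difference quotients with increments \<open>1/(n+1)\<close>.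
\<close>
lemma borel_measurable_deriv_on_open:
  fixes G :: "real \<Rightarrow> real"
  assumes U: "open U" and diff: "\<And>x. x \<in> U \<Longrightarrow> G differentiable at x"
  shows "(\<lambda>x. indicator U x * deriv G x) \<in> borel_measurable borel"
proof -
  \<comment> \<open>Only \<open>G\<close> cut off outside \<open>U\<close> is known to be measurable. The cut-off does not affect the limit:
    as \<open>U\<close> is open, \<open>x + 1/(n+1)\<close> lies in \<open>U\<close> for large \<open>n\<close>.\<close>
  define D where "D n x = indicator U x * (real (Suc n) *
    (indicator U (x + 1 / real (Suc n)) * G (x + 1 / real (Suc n)) - indicator U x * G x))" for n x
  have [measurable]: "(\<lambda>x. indicator U x * G x) \<in> borel_measurable borel"
    using U diff by (rule borel_measurable_differentiable_on_open)
  have [measurable]: "U \<in> sets borel"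
    using U by simp
  have D: "D n \<in> borel_measurable borel" for n
  proof -
    have "(\<lambda>x. indicator U (x + 1 / real (Suc n)) * G (x + 1 / real (Suc n)))
        \<in> borel_measurable borel"
      using measurable_compose[of "\<lambda>x. x + 1 / real (Suc n)" borel borel
          "\<lambda>x. indicator U x * G x" borel] by simp
    then show ?thesis
      unfolding D_def by measurable
  qed
  have "(\<lambda>n. D n x) \<longlonglongrightarrow> indicator U x * deriv G x" for x
  proof (cases "x \<in> U")
    case True
    have seq: "(\<lambda>n. x + 1 / real (Suc n)) \<longlonglongrightarrow> x"
      using tendsto_add[OF tendsto_const LIMSEQ_inverse_real_of_nat, of x]
      by (simp add: inverse_eq_divide)
    have ev: "eventually (\<lambda>n. x + 1 / real (Suc n) \<in> U) sequentially"
      using topological_tendstoD[OF seq U True] .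
    have "(G has_field_derivative deriv G x) (at x)"
      using diff[OF True] DERIV_deriv_iff_real_differentiable by blast
    then have "(\<lambda>h. (G (x + h) - G x) / h) \<midarrow>0\<rightarrow> deriv G x"
      by (simp add: DERIV_def)
    moreover have "filterlim (\<lambda>n. 1 / real (Suc n)) (at 0) sequentially"
      unfolding filterlim_at
      using LIMSEQ_inverse_real_of_nat by (simp add: inverse_eq_divide)
    ultimately have "(\<lambda>n. (G (x + 1 / real (Suc n)) - G x) / (1 / real (Suc n)))
        \<longlonglongrightarrow> deriv G x"
      by (rule filterlim_compose)
    then have "(\<lambda>n. D n x) \<longlonglongrightarrow> deriv G x"
      by (rule Lim_transform_eventually)
        (use ev in eventually_elim, use True in \<open>simp add: D_def field_simps\<close>)
    then show ?thesis using True by simp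
  qed (simp add: D_def)
  then show ?thesis
    using D by (rule borel_measurable_LIMSEQ_real)
qed

section \<open>The Cauchy--Schwarz inequality with a weight\<close>

lemma ennreal_sqrt_mono: "x \<le> y \<Longrightarrow> ennreal_sqrt x \<le> ennreal_sqrt y"
  by (auto simp: ennreal_sqrt_def top_unique less_top intro!: ennreal_leI enn2real_mono)

lemma power2_ennreal_sqrt: "(ennreal_sqrt x)\<^sup>2 = x"
  by (cases x) (auto simp: ennreal_sqrt_def ennreal_power)

lemma ennreal_sqrt_power2: "ennreal_sqrt (x\<^sup>2) = x"
  by (cases x) (auto simp: ennreal_sqrt_def ennreal_power)

lemma ennreal_sqrt_mult: "ennreal_sqrt (x * y) = ennreal_sqrt x * ennreal_sqrt y"
  by (metis power2_ennreal_sqrt ennreal_sqrt_power2 power_mult_distrib)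

lemma le_ennreal_sqrt: "x\<^sup>2 \<le> y \<Longrightarrow> x \<le> ennreal_sqrt y"
  by (metis ennreal_sqrt_mono ennreal_sqrt_power2)

text \<open>
  Cauchy--Schwarz for \<open>\<bar>u\<bar> sqrt w\<close> and \<open>\<bar>v\<bar> sqrt w\<close>. Measurability is only required on \<open>S\<close>,
  because test functions are arbitrary off the support and derivatives are measurable only where
  they are known to exist.
\<close>
lemma weighted_Cauchy_Schwarz:
  fixes u v w :: "'a \<Rightarrow> real"
  assumes u: "set_borel_measurable M S u"
    and v: "set_borel_measurable M S v" and w: "set_borel_measurable M S w"
    and pos: "\<And>x. x \<in> S \<Longrightarrow> 0 \<le> w x"
  shows "(\<integral>\<^sup>+x\<in>S. ennreal \<bar>u x * v x * w x\<bar> \<partial>M)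
    \<le> ennreal_sqrt (\<integral>\<^sup>+x\<in>S. ennreal ((u x)\<^sup>2 * w x) \<partial>M)
      * ennreal_sqrt (\<integral>\<^sup>+x\<in>S. ennreal ((v x)\<^sup>2 * w x) \<partial>M)"
proof -
  define U V where "U x = ennreal (\<bar>indicator S x * u x\<bar> * sqrt (indicator S x * w x))"
    and "V x = ennreal (\<bar>indicator S x * v x\<bar> * sqrt (indicator S x * w x))" for x
  have [measurable]: "(\<lambda>x. indicator S x * u x) \<in> borel_measurable M"
    "(\<lambda>x. indicator S x * v x) \<in> borel_measurable M"
    "(\<lambda>x. indicator S x * w x) \<in> borel_measurable M"
    using u v w by (simp_all add: set_borel_measurable_def)
  have meas: "U \<in> borel_measurable M" "V \<in> borel_measurable M"
    unfolding U_def V_def by measurable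
  have "U x * V x = ennreal \<bar>u x * v x * w x\<bar> * indicator S x" for x
    using pos[of x] by (auto simp: U_def V_def indicator_def abs_mult mult_ac
        simp flip: ennreal_mult)
  moreover have "(U x)\<^sup>2 = ennreal ((u x)\<^sup>2 * w x) * indicator S x"
    and "(V x)\<^sup>2 = ennreal ((v x)\<^sup>2 * w x) * indicator S x" for x
    using pos[of x] by (auto simp: U_def V_def indicator_def ennreal_power power_mult_distrib)
  ultimately show ?thesis
    using Cauchy_Schwarz_nn_integral[OF meas]
    by (simp add: le_ennreal_sqrt flip: ennreal_sqrt_mult)
qed

section \<open>Integrals modulo a total derivative\<close>

text \<open>
  Formally \<open>\<integral> g = \<integral> (g - G')\<close>, since \<open>G\<close> vanishes at both ends. Integrability of \<open>G'\<close> is not an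
  obstacle: either the right-hand side is infinite, or \<open>g - G'\<close> is Lebesgue integrable. In the
  second case its Lebesgue integral over a compact subinterval is also its gauge integral, which
  the fundamental theorem computes; the subintervals then increase to the whole interval.
\<close>
lemma abs_integral_le_nn_integral_diff_deriv:
  fixes g G :: "real \<Rightarrow> real" and c d :: ereal
  assumes "c < d"
    and diff: "\<And>x. x \<in> einterval c d \<Longrightarrow> G differentiable at x"
    and lim_c: "((G \<circ> real_of_ereal) \<longlongrightarrow> 0) (at_right c)"
    and lim_d: "((G \<circ> real_of_ereal) \<longlongrightarrow> 0) (at_left d)"
    and g: "set_integrable lborel (einterval c d) g"
  shows "ennreal \<bar>LBINT x:einterval c d. g x\<bar>
    \<le> (\<integral>\<^sup>+x\<in>einterval c d. ennreal \<bar>g x - deriv G x\<bar> \<partial>lborel)" (is "_ \<le> ?K")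
proof (cases "?K = top")
  case False
  define U h where "U = einterval c d" and "h x = g x - deriv G x" for x
  have [measurable]: "(\<lambda>x. indicator U x * deriv G x) \<in> borel_measurable borel"
    using diff by (intro borel_measurable_deriv_on_open) (auto simp: U_def)
  have [measurable]: "(\<lambda>x. indicator U x * g x) \<in> borel_measurable borel"
    using borel_measurable_integrable[OF g[unfolded set_integrable_def]] by (simp add: U_def)
  have "(\<lambda>x. indicator U x * g x - indicator U x * deriv G x) \<in> borel_measurable lborel"
    by measurable
  then have hm: "(\<lambda>x. indicator U x * h x) \<in> borel_measurable lborel"
    by (simp add: h_def algebra_simps)
  have K: "?K = (\<integral>\<^sup>+x. ennreal (norm (indicator U x * h x)) \<partial>lborel)"
    by (intro nn_integral_cong) (auto simp: U_def h_def indicator_def)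
  have h: "set_integrable lborel U h"
    using hm False K by (auto simp: set_integrable_def less_top intro!: integrableI_bounded)
  have sub: "ennreal \<bar>(LBINT x:{s..t}. g x) - (G t - G s)\<bar> \<le> ?K"
    if "c < ereal s" "s \<le> t" "ereal t < d" for s t
  proof -
    have st: "{s..t} \<subseteq> U"
      using that unfolding U_def einterval_def
      by (auto intro: less_le_trans le_less_trans simp flip: ereal_less_eq)
    have hst: "set_integrable lborel {s..t} h" and gst: "set_integrable lborel {s..t} g"
      using st h g by (auto intro: set_integrable_subset simp: U_def)
    have "(deriv G has_integral G t - G s) {s..t}"
    proof (rule fundamental_theorem_of_calculus[OF \<open>s \<le> t\<close>])
      fix x assume "x \<in> {s..t}"
      then have "G differentiable at x" using st diff by (auto simp: U_def)
      then show "(G has_vector_derivative deriv G x) (at x within {s..t})"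
        using DERIV_deriv_iff_real_differentiable has_field_derivative_at_within
          has_real_derivative_iff_has_vector_derivative by blast
    qed
    then have "(h has_integral (LBINT x:{s..t}. g x) - (G t - G s)) {s..t}"
      unfolding h_def using set_borel_integral_eq_integral[OF gst]
      by (auto intro!: has_integral_diff simp: has_integral_integral)
    then have "(LBINT x:{s..t}. g x) - (G t - G s) = (LBINT x:{s..t}. h x)"
      using set_borel_integral_eq_integral[OF hst] by (simp add: integral_unique)
    also have "ennreal \<bar>\<dots>\<bar> \<le> (\<integral>\<^sup>+x. ennreal (norm (indicator {s..t} x * h x)) \<partial>lborel)"
      using integral_norm_bound_ennreal[OF hst[unfolded set_integrable_def]]
      by (simp add: set_lebesgue_integral_def)
    also have "\<dots> \<le> ?K"
      unfolding K using st by (intro nn_integral_mono) (auto simp: indicator_def)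
    finally show ?thesis .
  qed
  obtain u l :: "nat \<Rightarrow> real" where ul: "einterval c d = (\<Union>i. {l i .. u i})"
    "incseq u" "decseq l" "\<And>i. l i < u i" "\<And>i. c < ereal (l i)" "\<And>i. ereal (u i) < d"
    "(\<lambda>i. ereal (l i)) \<longlonglongrightarrow> c" "(\<lambda>i. ereal (u i)) \<longlonglongrightarrow> d"
    by (rule einterval_Icc_approximation[OF \<open>c < d\<close>]) (rule that)
  have "(\<lambda>i. LBINT x:{l i..u i}. g x) \<longlonglongrightarrow> (LBINT x:einterval c d. g x)"
    unfolding ul(1) using ul(1) g \<open>incseq u\<close> \<open>decseq l\<close>
    by (intro set_integral_cont_up) (auto simp: incseq_def decseq_def intro: order_trans)
  moreover have "(\<lambda>i. G (u i)) \<longlonglongrightarrow> 0"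
    using filterlim_compose[OF lim_d, of "\<lambda>i. ereal (u i)" sequentially] ul
    by (simp add: filterlim_at less_imp_neq)
  moreover have "(\<lambda>i. G (l i)) \<longlonglongrightarrow> 0"
    using filterlim_compose[OF lim_c, of "\<lambda>i. ereal (l i)" sequentially] ul
    by (simp add: filterlim_at less_imp_neq[symmetric])
  ultimately have "(\<lambda>i. \<bar>(LBINT x:{l i..u i}. g x) - (G (u i) - G (l i))\<bar>)
      \<longlonglongrightarrow> \<bar>(LBINT x:einterval c d. g x) - (0 - 0)\<bar>"
    by (intro tendsto_intros)
  then have "(\<lambda>i. ennreal \<bar>(LBINT x:{l i..u i}. g x) - (G (u i) - G (l i))\<bar>)
      \<longlonglongrightarrow> ennreal \<bar>LBINT x:einterval c d. g x\<bar>"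
    by (intro tendsto_ennrealI) simp
  then show ?thesis
    by (rule LIMSEQ_le_const2) (use sub[OF ul(5) less_imp_le[OF ul(4)] ul(6)] in blast)
qed simp

section \<open>Stein operators of two densities\<close>

lemma density_class_differentiable:
  assumes "p \<in> density_class" "x \<in> interior (supp p)"
  shows "p differentiable at x"
  using assms interior_supp unfolding density_class_def by blast

text \<open>The Bochner integral of a function that is not integrable is 0, not 1.\<close>
lemma density_class_integrable:
  assumes "q \<in> density_class"
  shows "set_integrable lborel (supp q) q"
  using assms not_integrable_integral_eq
  unfolding density_class_def set_lebesgue_integral_def set_integrable_def by fastforce

text \<open>
  Both \<open>(f p) q\<close> and \<open>(f q) p\<close> are the product \<open>f p q\<close>; equating their derivatives by the product
  rule avoids any differentiation of \<open>f\<close> alone.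
\<close>
lemma stein_op_eq_deriv_plus_score_diff:
  assumes "0 < p x" "0 < q x"
    and "p differentiable at x" "q differentiable at x"
    and "(\<lambda>y. f y * p y) differentiable at x" "(\<lambda>y. f y * q y) differentiable at x"
  shows "stein_op p f x * q x = deriv (\<lambda>y. f y * q y) x + f x * score_diff p q x * q x"
proof -
  let ?P = "\<lambda>y. f y * p y" and ?Q = "\<lambda>y. f y * q y"
  note D = assms(3-)[folded DERIV_deriv_iff_real_differentiable]
  have "((\<lambda>y. ?P y * q y) has_field_derivative deriv ?P x * q x + deriv q x * ?P x) (at x)"
    using D by (intro DERIV_mult)
  moreover have "((\<lambda>y. ?Q y * p y) has_field_derivative deriv ?Q x * p x + deriv p x * ?Q x) (at x)"
    using D by (intro DERIV_mult)
  moreover have "(\<lambda>y. ?P y * q y) = (\<lambda>y. ?Q y * p y)"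
    by (simp add: mult_ac)
  ultimately have "deriv ?P x * q x + deriv q x * ?P x = deriv ?Q x * p x + deriv p x * ?Q x"
    by (metis DERIV_unique)
  then have "deriv ?P x * q x = deriv ?Q x * p x + deriv p x * ?Q x - deriv q x * ?P x"
    by simp
  then have "1 / p x * deriv ?P x * q x
      = (deriv ?Q x * p x + deriv p x * ?Q x - deriv q x * ?P x) / p x"
    by simp
  also have "\<dots> = deriv ?Q x + f x * score_diff p q x * q x"
    using assms(1,2) by (simp add: score_diff_def supp_def field_simps)
  finally show ?thesis
    by (simp add: stein_op_def)
qed

text \<open>
  Apply \<open>abs_integral_le_nn_integral_diff_deriv\<close> to \<open>g = (l - E_p l) q\<close> and \<open>G = f q\<close>, for which the
  comparison of Stein operators identifies \<open>g - G'\<close> with \<open>f r q\<close>.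
\<close>
lemma expect_diff_le_nn_integral_score_diff:
  assumes p: "p \<in> density_class" and q: "q \<in> density_class" and "supp q \<subseteq> supp p"
    and l: "expect_exists q l" and stein: "stein_equation p l f"
    and fp: "f \<in> test_functions p" and fq: "f \<in> test_functions q"
  shows "ennreal \<bar>expect q l - expect p l\<bar>
    \<le> (\<integral>\<^sup>+x\<in>interior (supp q). ennreal \<bar>f x * score_diff p q x * q x\<bar> \<partial>lborel)"
proof -
  define U where "U = interior (supp q)"
  define g where "g x = (l x - expect p l) * q x" for x
  obtain c d where cd: "support_ends q c d"
    and lim: "(((\<lambda>y. f y * q y) \<circ> real_of_ereal) \<longlongrightarrow> 0) (at_right c)"
      "(((\<lambda>y. f y * q y) \<circ> real_of_ereal) \<longlongrightarrow> 0) (at_left d)"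
    using fq unfolding test_functions_def by blast
  have U: "U = einterval c d"
    by (simp add: U_def interior_supp[OF cd])
  have Up: "U \<subseteq> interior (supp p)"
    unfolding U_def by (rule interior_mono) fact
  have Uq: "U \<subseteq> supp q"
    unfolding U_def by (rule interior_subset)
  have int_lq: "set_integrable lborel (supp q) (\<lambda>x. l x * q x)"
    using l by (simp add: expect_exists_def)
  have int_cq: "set_integrable lborel (supp q) (\<lambda>x. expect p l * q x)"
    using density_class_integrable[OF q] by simp
  have int_g: "set_integrable lborel (supp q) g"
    unfolding g_def left_diff_distrib using int_lq int_cq by (rule set_integral_diff)
  have "(LBINT x:supp q. g x) = (LBINT x:supp q. l x * q x) - (LBINT x:supp q. expect p l * q x)"
    unfolding g_def left_diff_distrib using int_lq int_cq by (rule set_integral_diff)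
  also have "\<dots> = expect q l - expect p l"
    using q by (simp add: expect_def density_class_def)
  finally have expect: "(LBINT x:supp q. g x) = expect q l - expect p l" .
  have "AE x in lborel. x \<notin> supp q - U"
    unfolding U_def by (rule AE_not_in[OF null_supp_boundary[OF cd]])
  then have AE: "AE x in lborel. (x \<in> supp q) = (x \<in> U)"
    by eventually_elim (use Uq in auto)
  have int_gU: "set_integrable lborel U g"
    using int_g by (rule set_integrable_subset) (use Uq in \<open>auto simp: U\<close>)
  moreover have "(LBINT x:U. g x) = (LBINT x:supp q. g x)"
    using int_g int_gU AE by (intro set_integral_cong_set)
      (auto simp: set_borel_measurable_def set_integrable_def)
  moreover have "g x - deriv (\<lambda>y. f y * q y) x = f x * score_diff p q x * q x" if "x \<in> U" for x
  proof -
    have "x \<in> interior (supp p)" "x \<in> interior (supp q)"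
      using that Up U_def by auto
    moreover from this have "x \<in> supp p" "x \<in> supp q"
      using interior_subset by blast+
    ultimately have "stein_op p f x * q x = deriv (\<lambda>y. f y * q y) x + f x * score_diff p q x * q x"
      using p q fp fq
      by (intro stein_op_eq_deriv_plus_score_diff)
        (auto simp: density_class_differentiable test_functions_def supp_def)
    moreover have "stein_op p f x = l x - expect p l"
      using stein \<open>x \<in> interior (supp p)\<close> \<open>x \<in> supp p\<close> by (auto simp: stein_equation_def)
    ultimately show ?thesis
      by (simp add: g_def)
  qed
  then have "(\<integral>\<^sup>+x\<in>U. ennreal \<bar>g x - deriv (\<lambda>y. f y * q y) x\<bar> \<partial>lborel)
      = (\<integral>\<^sup>+x\<in>U. ennreal \<bar>f x * score_diff p q x * q x\<bar> \<partial>lborel)"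
    by (intro nn_integral_cong) (auto simp: indicator_def)
  moreover have "(\<lambda>y. f y * q y) differentiable at x" if "x \<in> U" for x
    using fq that by (auto simp: test_functions_def U_def)
  ultimately show ?thesis
    using abs_integral_le_nn_integral_diff_deriv[of c d "\<lambda>y. f y * q y" g] cd lim expect U
    by (simp add: support_ends_def U_def)
qed

section \<open>The bound by the Fisher information distance\<close>

lemma set_borel_measurable_score_diff:
  assumes p: "p \<in> density_class" and q: "q \<in> density_class" and "supp q \<subseteq> supp p"
  shows "set_borel_measurable lborel (interior (supp q)) (score_diff p q)"
proof -
  let ?U = "interior (supp q)"
  have Up: "?U \<subseteq> interior (supp p)"
    by (rule interior_mono) fact
  have [measurable]: "(\<lambda>x. indicator ?U x * p x) \<in> borel_measurable borel"
    "(\<lambda>x. indicator ?U x * deriv p x) \<in> borel_measurable borel"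
    "(\<lambda>x. indicator ?U x * q x) \<in> borel_measurable borel"
    "(\<lambda>x. indicator ?U x * deriv q x) \<in> borel_measurable borel"
    using p q Up
    by (auto intro!: borel_measurable_differentiable_on_open borel_measurable_deriv_on_open
        density_class_differentiable)
  have "(\<lambda>x. (indicator ?U x * deriv p x) / (indicator ?U x * p x)
      - (indicator ?U x * deriv q x) / (indicator ?U x * q x)) \<in> borel_measurable borel"
    by measurable
  also have "(\<lambda>x. (indicator ?U x * deriv p x) / (indicator ?U x * p x)
      - (indicator ?U x * deriv q x) / (indicator ?U x * q x))
    = (\<lambda>x. indicator ?U x * score_diff p q x)"
    using Up interior_subset[of "supp p"] by (auto simp: fun_eq_iff score_diff_def indicator_def)
  finally show ?thesis
    by (simp add: set_borel_measurable_def)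
qed

text \<open>Write \<open>f\<close> as the quotient of \<open>f q\<close> and \<open>q\<close>, which are continuous on the interior.\<close>
lemma set_borel_measurable_test_function:
  assumes q: "q \<in> density_class" and f: "f \<in> test_functions q"
  shows "set_borel_measurable lborel (interior (supp q)) f"
proof -
  let ?U = "interior (supp q)"
  have [measurable]: "(\<lambda>x. indicator ?U x * q x) \<in> borel_measurable borel"
    "(\<lambda>x. indicator ?U x * (f x * q x)) \<in> borel_measurable borel"
    using density_class_differentiable[OF q] f
    by (auto intro!: borel_measurable_differentiable_on_open simp: test_functions_def)
  have "(\<lambda>x. (indicator ?U x * (f x * q x)) / (indicator ?U x * q x)) \<in> borel_measurable borel"
    by measurable
  also have "(\<lambda>x. (indicator ?U x * (f x * q x)) / (indicator ?U x * q x))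
    = (\<lambda>x. indicator ?U x * f x)"
    using interior_subset[of "supp q"] by (auto simp: fun_eq_iff indicator_def supp_def)
  finally show ?thesis
    by (simp add: set_borel_measurable_def)
qed

lemma nn_integral_score_diff_le:
  assumes p: "p \<in> density_class" and q: "q \<in> density_class" and "supp q \<subseteq> supp p"
    and f: "f \<in> test_functions q"
  shows "(\<integral>\<^sup>+x\<in>interior (supp q). ennreal \<bar>f x * score_diff p q x * q x\<bar> \<partial>lborel)
    \<le> ennreal_sqrt (nn_expect q (\<lambda>x. (f x)\<^sup>2)) * ennreal_sqrt (fisher_dist p q)"
proof -
  let ?U = "interior (supp q)"
  have nn_mono: "(\<integral>\<^sup>+x\<in>?U. ennreal (k x * q x) \<partial>lborel) \<le> nn_expect q k" for k
    unfolding nn_expect_def using interior_subset[of "supp q"]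
    by (intro nn_integral_mono) (auto simp: indicator_def)
  have "set_borel_measurable lborel ?U q"
    using borel_measurable_differentiable_on_open[of ?U q] density_class_differentiable[OF q]
    by (simp add: set_borel_measurable_def)
  then have "(\<integral>\<^sup>+x\<in>?U. ennreal \<bar>f x * score_diff p q x * q x\<bar> \<partial>lborel)
      \<le> ennreal_sqrt (\<integral>\<^sup>+x\<in>?U. ennreal ((f x)\<^sup>2 * q x) \<partial>lborel)
        * ennreal_sqrt (\<integral>\<^sup>+x\<in>?U. ennreal ((score_diff p q x)\<^sup>2 * q x) \<partial>lborel)"
    using set_borel_measurable_test_function[OF q f]
      set_borel_measurable_score_diff[OF p q \<open>supp q \<subseteq> supp p\<close>] q
    by (intro weighted_Cauchy_Schwarz) (auto simp: density_class_def)
  also have "\<dots> \<le> ennreal_sqrt (nn_expect q (\<lambda>x. (f x)\<^sup>2)) * ennreal_sqrt (fisher_dist p q)"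
    unfolding fisher_dist_def by (intro mult_mono ennreal_sqrt_mono nn_mono) simp_all
  finally show ?thesis .
qed

theorem theorem3p1:
  fixes p q :: "real \<Rightarrow> real"
    and H :: "(real \<Rightarrow> real) set"
    and F :: "(real \<Rightarrow> real) \<Rightarrow> real \<Rightarrow> real"
  assumes "p \<in> density_class" and "q \<in> density_class"
    and "supp q \<subseteq> supp p"
    and "test_functions p \<inter> test_functions q \<noteq> {}"
    and "\<And>l. l \<in> H \<Longrightarrow> expect_exists p l \<and> expect_exists q l"
    and "\<And>l. l \<in> H \<Longrightarrow> stein_equation p l (F l)"
    and "\<And>l. l \<in> H \<Longrightarrow> F l \<in> test_functions p \<inter> test_functions q"
  shows "sup_dist H p q \<le> kappa H F q * ennreal_sqrt (fisher_dist p q)"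
  unfolding sup_dist_def
proof (rule SUP_least)
  fix l assume l: "l \<in> H"
  have "ennreal \<bar>expect q l - expect p l\<bar>
      \<le> (\<integral>\<^sup>+x\<in>interior (supp q). ennreal \<bar>F l x * score_diff p q x * q x\<bar> \<partial>lborel)"
    using assms l by (intro expect_diff_le_nn_integral_score_diff) auto
  also have "\<dots> \<le> ennreal_sqrt (nn_expect q (\<lambda>x. (F l x)\<^sup>2)) * ennreal_sqrt (fisher_dist p q)"
    using assms l by (intro nn_integral_score_diff_le) auto
  also have "\<dots> \<le> kappa H F q * ennreal_sqrt (fisher_dist p q)"
    unfolding kappa_def using l by (intro mult_right_mono SUP_upper) auto
  finally show "ennreal \<bar>expect q l - expect p l\<bar> \<le> kappa H F q * ennreal_sqrt (fisher_dist p q)" .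
qed

end
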